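(* For $m\in\mathbb N$ let $\mathcal P_m$ be the Markov kernel of the random walk Metropolis (RWM) algorithm with step size parameter $\delta_m$ applied to the Gaussian target $$\mu_m=\gamma_m=\mathcal L\Bigl(\sum_{i=1}^m\frac1i\xi_ie_i\Bigr),\qquad \xi_i\ \text{i.i.d.}\ \mathcal N(0,1),$$ and let $1-\beta_m$ be its $L^2_{\mu_m}$-spectral gap. (1) If $\delta_m\sim m^{-a}$ with $a\in[0,1)$, then for any $p>0$ there exists a constant $K(p,a)$ such that $$1-\beta_m\le K(p,a)\,m^{-p}\quad\text{for all } m.$$ (2) If $\delta_m\sim m^{-a}$ with $a\in[1,\infty)$, then there exists a constant $K(a)$ such that $$1-\beta_m\le K(a)\,m^{-a/2}\quad\text{for all } m.$$
   Context: $\mathcal L(\cdot)$ denotes the law of a random variable, and $e_1,\dots,e_m$ are orthonormal vectors; points of their span are identified with $x=(x_1,\dots,x_m)\in\mathbb R^m$. The notation $\delta_m\sim m^{-a}$ means $\delta_m=s\,m^{-a}$ for a fixed constant $s>0$ (the constants $K$ may depend on $s$). The RWM algorithm with step size $\delta$ and target $\gamma_m$: from $X_n$, draw $\xi\sim\gamma_m$ independently, set $p=X_n+\sqrt{2\delta}\,\xi$, and let $X_{n+1}=p$ with probability $\alpha(X_n,p)$ and $X_{n+1}=X_n$ otherwise, where $\alpha(x,y)=1\wedge\exp\bigl(\tfrac12\sum_{i=1}^m i^2x_i^2-\tfrac12\sum_{i=1}^m i^2y_i^2\bigr)$. The $L^2_\mu$-spectral gap of a Markov operator $\mathcal P$ with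 invariant measure $\mu$ is $1-\beta$, where $\beta=\sup_f\frac{\|\mathcal Pf-\mu(f)\|_2}{\|f-\mu(f)\|_2}$, the supremum being over non-constant $f\in L^2(\mu)$. *)

theory Defs
  imports "HOL-Probability.Probability"
begin

text \<open>
  Points of \<open>span {e\<^sub>1, \<dots>, e\<^sub>m}\<close> are represented by their coordinates, as extensional functions on
  \<open>{1..m}\<close>, so that the dimension \<open>m\<close> can be quantified over.
\<close>

abbreviation state_space :: "nat \<Rightarrow> (nat \<Rightarrow> real) measure" where
  "state_space m \<equiv> \<Pi>\<^sub>M i\<in>{1..m}. (borel :: real measure)"

definition gauss_target :: "nat \<Rightarrow> (nat \<Rightarrow> real) measure" where
  "gauss_target m =
     distr (\<Pi>\<^sub>M i\<in>{1..m}. density lborel std_normal_density) (state_space m)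
       (\<lambda>\<xi>. \<lambda>i\<in>{1..m}. 1 / real i * \<xi> i)"

definition rwm_accept :: "nat \<Rightarrow> (nat \<Rightarrow> real) \<Rightarrow> (nat \<Rightarrow> real) \<Rightarrow> real" where
  "rwm_accept m x y =
     min 1 (exp (1/2 * (\<Sum>i=1..m. (real i)\<^sup>2 * (x i)\<^sup>2) - 1/2 * (\<Sum>i=1..m. (real i)\<^sup>2 * (y i)\<^sup>2)))"

definition rwm_proposal :: "nat \<Rightarrow> real \<Rightarrow> (nat \<Rightarrow> real) \<Rightarrow> (nat \<Rightarrow> real) \<Rightarrow> (nat \<Rightarrow> real)" where
  "rwm_proposal m \<delta> x \<xi> = (\<lambda>i\<in>{1..m}. x i + sqrt (2 * \<delta>) * \<xi> i)"

text \<open>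
  The transition law of one step from \<open>x\<close>. The accept/reject decision is realised by an independent
  variable \<open>u\<close>, uniform on \<open>[0,1]\<close>: the event \<open>u \<le> \<alpha>\<close> has probability \<open>\<alpha>\<close>.
\<close>

definition rwm_kernel :: "nat \<Rightarrow> real \<Rightarrow> (nat \<Rightarrow> real) \<Rightarrow> (nat \<Rightarrow> real) measure" where
  "rwm_kernel m \<delta> x =
     distr (gauss_target m \<Otimes>\<^sub>M uniform_measure lborel {0..1::real}) (state_space m)
       (\<lambda>(\<xi>, u). if u \<le> rwm_accept m x (rwm_proposal m \<delta> x \<xi>) then rwm_proposal m \<delta> x \<xi> else x)"

definition markov_op :: "('a \<Rightarrow> 'a measure) \<Rightarrow> ('a \<Rightarrow> real) \<Rightarrow> 'a \<Rightarrow> real" where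
  "markov_op P f x = (\<integral>y. f y \<partial>P x)"

definition L2 :: "'a measure \<Rightarrow> ('a \<Rightarrow> real) set" where
  "L2 \<mu> = {f \<in> borel_measurable \<mu>. integrable \<mu> (\<lambda>x. (f x)\<^sup>2)}"

definition L2_norm :: "'a measure \<Rightarrow> ('a \<Rightarrow> real) \<Rightarrow> real" where
  "L2_norm \<mu> f = sqrt (\<integral>x. (f x)\<^sup>2 \<partial>\<mu>)"

text \<open>
  Non-constant is meant in the sense of elements of \<open>L\<^sup>2(\<mu>)\<close>, i.e. not almost everywhere equal to a
  constant. The supremum is taken in \<open>ereal\<close> so that it does not depend on boundedness
  of the ratios; for a kernel with invariant probability measure \<open>\<mu>\<close> they are at most \<open>1\<close>.
\<close>

definition L2_beta :: "'a measure \<Rightarrow> ('a \<Rightarrow> 'a measure) \<Rightarrow> ereal" where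
  "L2_beta \<mu> P =
     (SUP f \<in> {f \<in> L2 \<mu>. \<not> (\<exists>c. AE x in \<mu>. f x = c)}.
        ereal (L2_norm \<mu> (\<lambda>x. markov_op P f x - (\<integral>y. f y \<partial>\<mu>)) /
               L2_norm \<mu> (\<lambda>x. f x - (\<integral>y. f y \<partial>\<mu>))))"

definition L2_spectral_gap :: "'a measure \<Rightarrow> ('a \<Rightarrow> 'a measure) \<Rightarrow> ereal" where
  "L2_spectral_gap \<mu> P = 1 - L2_beta \<mu> P"

end

theory Submission
  imports Defs "HOL-Real_Asymp.Real_Asymp"
begin

text \<open>
  The spectral gap is bounded from above by a single test function, the first coordinate
  \<open>f x = x 1\<close>, which has variance \<open>1\<close> under the target. Since \<open>f\<close> is centred, the triangle inequality in
  \<open>L\<^sup>2\<close> gives \<open>1 - \<beta> \<le> \<parallel>P f - f\<parallel>\<close> (lemma \<open>L2_spectral_gap_le_displacement\<close>), so it suffices to see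
  that one step of the chain hardly moves the first coordinate. There are two reasons for this.

  An accepted move changes \<open>x 1\<close> only by \<open>sqrt (2 * \<delta>) * \<xi> 1\<close>. This alone bounds the gap by a multiple of
  \<open>sqrt \<delta>\<close>, which is the claim for \<open>a \<ge> 1\<close>.

  Moves are also rarely accepted. In stationarity the logarithm of the density ratio is a sum of \<open>m\<close>
  independent terms with mean \<open>- \<delta>\<close> and, for bounded \<open>\<delta>\<close>, variance of order \<open>\<delta>\<close>. It is therefore close to \<open>- m * \<delta>\<close> when
  \<open>m * \<delta>\<close> is large. An exponential moment makes this precise:
  \<open>min 1 r \<le> sqrt r\<close>, and the mean of the square root of the ratio \<open>r\<close> is a product of \<open>m\<close> one-dimensional Gaussian
  integrals, each equal to \<open>(1 + \<delta> / 2) powr (- 1/2)\<close> (lemma \<open>expected_weighted_acceptance\<close>,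
  where the size of the move enters as an additional weight in one of the factors). For
  \<open>\<delta> = s * m powr (- a)\<close> with \<open>a < 1\<close> this product decays like \<open>exp (- c * m powr (1 - a))\<close>, faster
  than any power of \<open>m\<close>.

  Both effects are contained in the one estimate \<open>rwm_spectral_gap_le\<close>.
\<close>

section \<open>Integrals against the standard Gaussian\<close>

abbreviation std_gauss :: "real measure" where
  "std_gauss \<equiv> density lborel std_normal_density"

lemma prob_space_std_gauss: "prob_space std_gauss"
  by (rule prob_space_normal_density) simp

text \<open>Completing the square turns the weight \<open>exp (c * z)\<close> into a shift of the mean to \<open>c\<close>.\<close>

lemma nn_integral_std_gauss_exp_linear:
  fixes c :: real
  shows "(\<integral>\<^sup>+z. ennreal (exp (c * z)) \<partial>std_gauss) = ennreal (exp (c\<^sup>2 / 2))"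
proof -
  have eq: "std_normal_density z * exp (c * z) = exp (c\<^sup>2 / 2) * normal_density c 1 z" for z
    by (simp add: normal_density_def mult_exp_exp)
      (simp add: power2_eq_square field_simps)
  have "(\<integral>\<^sup>+z. ennreal (exp (c * z)) \<partial>std_gauss)
      = (\<integral>\<^sup>+z. ennreal (exp (c\<^sup>2 / 2)) * ennreal (normal_density c 1 z) \<partial>lborel)"
    by (subst nn_integral_density) (auto simp: ennreal_mult'[symmetric] eq)
  also have "\<dots> = ennreal (exp (c\<^sup>2 / 2)) * (\<integral>\<^sup>+z. ennreal (normal_density c 1 z) \<partial>lborel)"
    by (rule nn_integral_cmult) simp
  also have "(\<integral>\<^sup>+z. ennreal (normal_density c 1 z) \<partial>lborel) = 1"
    by (simp add: nn_integral_eq_integral normal_density_nonneg)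
  finally show ?thesis by simp
qed

text \<open>The weight rescales the variance from \<open>1\<close> to \<open>1 / (1 + 2 * b)\<close>, and what remains is the ratio of
  the two normalising constants.\<close>

lemma nn_integral_std_gauss_exp_neg_square:
  fixes b :: real
  assumes "b \<ge> 0"
  shows "(\<integral>\<^sup>+w. ennreal (exp (- (b * w\<^sup>2))) \<partial>std_gauss) = ennreal ((1 + 2 * b) powr (- 1/2))"
proof -
  define \<sigma> where "\<sigma> = (1 + 2 * b) powr (- 1/2)"
  have \<sigma>: "\<sigma> > 0" using assms by (simp add: \<sigma>_def)
  have "\<sigma>\<^sup>2 = (1 + 2 * b) powr (- 1)"
    using powr_add[of "1 + 2 * b" "- 1/2" "- 1/2"] by (simp add: \<sigma>_def power2_eq_square)
  then have \<sigma>2: "\<sigma>\<^sup>2 = 1 / (1 + 2 * b)"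
    using assms by (simp add: powr_minus_divide)
  have eq: "std_normal_density w * exp (- (b * w\<^sup>2)) = \<sigma> * normal_density 0 \<sigma> w" for w
  proof -
    have "sqrt (2 * pi * \<sigma>\<^sup>2) = sqrt (2 * pi) * \<sigma>"
      using \<sigma> by (simp add: real_sqrt_mult)
    moreover have "- w\<^sup>2 / 2 + - (b * w\<^sup>2) = - (w - 0)\<^sup>2 / (2 * \<sigma>\<^sup>2)"
      using assms by (simp add: \<sigma>2 field_simps)
    ultimately show ?thesis
      using \<sigma> by (simp add: normal_density_def mult_exp_exp)
  qed
  have "(\<integral>\<^sup>+w. ennreal (exp (- (b * w\<^sup>2))) \<partial>std_gauss)
      = (\<integral>\<^sup>+w. ennreal \<sigma> * ennreal (normal_density 0 \<sigma> w) \<partial>lborel)"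
    using \<sigma> by (subst nn_integral_density) (auto simp: ennreal_mult'[symmetric] eq)
  also have "\<dots> = ennreal \<sigma> * (\<integral>\<^sup>+w. ennreal (normal_density 0 \<sigma> w) \<partial>lborel)"
    by (rule nn_integral_cmult) simp
  also have "(\<integral>\<^sup>+w. ennreal (normal_density 0 \<sigma> w) \<partial>lborel) = 1"
    using \<sigma> by (simp add: nn_integral_eq_integral normal_density_nonneg)
  finally show ?thesis by (simp add: \<sigma>_def)
qed

lemma nn_integral_std_gauss_square:
  "(\<integral>\<^sup>+w. ennreal (w\<^sup>2) \<partial>std_gauss) = 1"
proof -
  have "(\<integral>\<^sup>+w. ennreal (w\<^sup>2) \<partial>std_gauss)
      = (\<integral>\<^sup>+w. ennreal (std_normal_density w * w\<^sup>2) \<partial>lborel)"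
    by (subst nn_integral_density) (auto simp: ennreal_mult'[symmetric])
  also have "\<dots> = ennreal (\<integral>w. std_normal_density w * w\<^sup>2 \<partial>lborel)"
    using integrable_std_normal_moment[of 2] by (intro nn_integral_eq_integral) auto
  also have "(\<integral>w. std_normal_density w * w\<^sup>2 \<partial>lborel) = 1"
    using integral_std_normal_moment_even[of 1] by (simp add: fact_numeral)
  finally show ?thesis by simp
qed

section \<open>The target measure\<close>

lemma measurable_coord_scale:
  "(\<lambda>z. \<lambda>i\<in>{1..m}. 1 / real i * z i) \<in> (\<Pi>\<^sub>M i\<in>{1..m}. std_gauss) \<rightarrow>\<^sub>M state_space m"
proof (rule measurable_restrict)
  fix i assume "i \<in> {1..m}"
  then have [measurable]: "(\<lambda>z. z i) \<in> (\<Pi>\<^sub>M i\<in>{1..m}. std_gauss) \<rightarrow>\<^sub>M std_gauss"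
    by (rule measurable_component_singleton)
  show "(\<lambda>z. 1 / real i * z i) \<in> (\<Pi>\<^sub>M i\<in>{1..m}. std_gauss) \<rightarrow>\<^sub>M borel"
    using measurable_component_singleton[OF \<open>i \<in> {1..m}\<close>, of "\<lambda>_. std_gauss"]
    by (intro borel_measurable_times) (auto cong: measurable_cong_sets)
qed

lemma sets_gauss_target [measurable_cong]: "sets (gauss_target m) = sets (state_space m)"
  by (simp add: gauss_target_def)

lemma space_gauss_target: "space (gauss_target m) = space (state_space m)"
  by (simp add: gauss_target_def)

lemma prob_space_gauss_target: "prob_space (gauss_target m)"
  unfolding gauss_target_def
  by (intro prob_space.prob_space_distr prob_space_PiM prob_space_std_gauss measurable_coord_scale)

lemma nn_integral_gauss_target:
  assumes "F \<in> borel_measurable (state_space m)"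
  shows "(\<integral>\<^sup>+x. F x \<partial>gauss_target m)
    = (\<integral>\<^sup>+z. F (\<lambda>i\<in>{1..m}. 1 / real i * z i) \<partial>(\<Pi>\<^sub>M i\<in>{1..m}. std_gauss))"
  unfolding gauss_target_def
  by (rule nn_integral_distr[OF measurable_coord_scale]) (use assms in simp)

lemma distr_gauss_target_first:
  assumes "m \<ge> 1"
  shows "distr (gauss_target m) borel (\<lambda>x. x 1) = std_gauss"
proof -
  have 1: "1 \<in> {1..m}" using assms by simp
  have "distr (gauss_target m) borel (\<lambda>x. x 1)
      = distr (\<Pi>\<^sub>M i\<in>{1..m}. std_gauss) borel ((\<lambda>x. x 1) \<circ> (\<lambda>z. \<lambda>i\<in>{1..m}. 1 / real i * z i))"
    unfolding gauss_target_def
    using 1 by (intro distr_distr measurable_coord_scale measurable_component_singleton)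
  also have "(\<lambda>x. x 1) \<circ> (\<lambda>z. \<lambda>i\<in>{1..m}. 1 / real i * z i) = (\<lambda>z. z 1)"
    using 1 by (auto simp: fun_eq_iff)
  also have "distr (\<Pi>\<^sub>M i\<in>{1..m}. std_gauss) borel (\<lambda>z. z 1)
      = distr (\<Pi>\<^sub>M i\<in>{1..m}. std_gauss) std_gauss (\<lambda>z. z 1)"
    by (rule distr_cong) auto
  also have "\<dots> = std_gauss"
    using 1 by (intro distr_PiM_component prob_space_std_gauss)
  finally show ?thesis .
qed

section \<open>The acceptance probability\<close>

lemma rwm_accept_proposal:
  "rwm_accept m x (rwm_proposal m \<delta> x \<xi>) =
     min 1 (exp (1/2 * (\<Sum>i=1..m. (real i)\<^sup>2 * (x i)\<^sup>2)
               - 1/2 * (\<Sum>i=1..m. (real i)\<^sup>2 * (x i + sqrt (2 * \<delta>) * \<xi> i)\<^sup>2)))"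
  by (simp add: rwm_accept_def rwm_proposal_def)

lemma measurable_rwm_accept:
  assumes [measurable]: "f \<in> M \<rightarrow>\<^sub>M state_space m" "g \<in> M \<rightarrow>\<^sub>M state_space m"
  shows "(\<lambda>\<omega>. rwm_accept m (f \<omega>) (rwm_proposal m \<delta> (f \<omega>) (g \<omega>))) \<in> borel_measurable M"
proof -
  have "(\<lambda>(x, \<xi>). rwm_accept m x (rwm_proposal m \<delta> x \<xi>))
     \<in> borel_measurable (state_space m \<Otimes>\<^sub>M state_space m)"
    unfolding rwm_accept_proposal by measurable
  from measurable_compose[OF measurable_Pair[OF assms] this] show ?thesis by simp
qed

lemma measurable_rwm_proposal:
  assumes [measurable]: "f \<in> M \<rightarrow>\<^sub>M state_space m" "g \<in> M \<rightarrow>\<^sub>M state_space m"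
  shows "(\<lambda>\<omega>. rwm_proposal m \<delta> (f \<omega>) (g \<omega>)) \<in> M \<rightarrow>\<^sub>M state_space m"
proof -
  have "(\<lambda>(x, \<xi>). rwm_proposal m \<delta> x \<xi>)
     \<in> state_space m \<Otimes>\<^sub>M state_space m \<rightarrow>\<^sub>M state_space m"
    unfolding rwm_proposal_def split_beta by measurable
  from measurable_compose[OF measurable_Pair[OF assms] this] show ?thesis by simp
qed

lemma measurable_first_coord:
  "m \<ge> 1 \<Longrightarrow> (\<lambda>x. x 1) \<in> borel_measurable (state_space m)"
  by (rule measurable_component_singleton) simp

lemma measurable_first_coord_gauss_target:
  "m \<ge> 1 \<Longrightarrow> (\<lambda>x. x 1) \<in> borel_measurable (gauss_target m)"
  by (subst measurable_cong_sets[OF sets_gauss_target refl]) (rule measurable_first_coord)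

lemma measurable_mean_weighted_acceptance:
  assumes m: "m \<ge> 1"
  shows "(\<lambda>x. \<integral>\<^sup>+\<xi>. ennreal ((\<xi> 1)\<^sup>2 * rwm_accept m x (rwm_proposal m \<delta> x \<xi>)) \<partial>gauss_target m)
    \<in> borel_measurable (state_space m)"
proof -
  interpret T: prob_space "gauss_target m" by (rule prob_space_gauss_target)
  note measurable_compose[OF measurable_snd measurable_first_coord[OF m], measurable]
  have [measurable]: "(\<lambda>p. rwm_accept m (fst p) (rwm_proposal m \<delta> (fst p) (snd p)))
      \<in> borel_measurable (state_space m \<Otimes>\<^sub>M gauss_target m)"
    by (rule measurable_rwm_accept) measurable
  have "(\<lambda>(x, \<xi>). ennreal ((\<xi> 1)\<^sup>2 * rwm_accept m x (rwm_proposal m \<delta> x \<xi>)))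
      \<in> borel_measurable (state_space m \<Otimes>\<^sub>M gauss_target m)"
    unfolding split_beta by measurable
  then show ?thesis by (rule T.borel_measurable_nn_integral)
qed

text \<open>
  The heart of the matter. In the whitened coordinates \<open>z i = i * x i\<close>, \<open>w i = i * \<xi> i\<close> the logarithm of
  the density ratio is a sum over the coordinates, so the bound \<open>min 1 (exp (2 * e)) \<le> exp e\<close> makes
  the integrand a product over the coordinates. With \<open>h = sqrt (2 * \<delta>)\<close>, the factor of
  coordinate \<open>i\<close> is \<open>exp (- h w z / 2 - h\<^sup>2 w\<^sup>2 / 4)\<close>. Integrating over \<open>z\<close> first leaves
  \<open>exp (h\<^sup>2 w\<^sup>2 / 8 - h\<^sup>2 w\<^sup>2 / 4) = exp (- \<delta> w\<^sup>2 / 4)\<close>, whose Gaussian mean is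
  \<open>(1 + \<delta> / 2)\<close> to the power \<open>- 1 / 2\<close>. The first coordinate carries the extra weight \<open>w\<^sup>2\<close> and is
  estimated by \<open>1\<close> only, which explains \<open>m - 1\<close> in the exponent.
\<close>

lemma expected_weighted_acceptance:
  assumes m: "m \<ge> 1" and \<delta>: "\<delta> > 0"
  shows "(\<integral>\<^sup>+x. \<integral>\<^sup>+\<xi>. ennreal ((\<xi> 1)\<^sup>2 * rwm_accept m x (rwm_proposal m \<delta> x \<xi>))
            \<partial>gauss_target m \<partial>gauss_target m)
          \<le> ennreal ((1 + \<delta> / 2) powr (- (real m - 1) / 2))"
proof -
  define h where "h = sqrt (2 * \<delta>)"
  have h2: "h\<^sup>2 = 2 * \<delta>" using \<delta> by (simp add: h_def)
  let ?G = "\<Pi>\<^sub>M i\<in>{1..m}. std_gauss"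
  let ?R = "\<lambda>z. \<lambda>i\<in>{1..m}. 1 / real i * z i"
  have 1 [simp]: "1 \<in> {1..m}" using m by simp
  interpret G: prob_space ?G by (intro prob_space_PiM prob_space_std_gauss)
  interpret GG: pair_sigma_finite ?G ?G ..
  interpret N: prob_space std_gauss by (rule prob_space_std_gauss)
  interpret P: product_sigma_finite "\<lambda>_::nat. std_gauss" ..
  have coord [measurable]: "(\<lambda>z. z i) \<in> borel_measurable ?G" if "i \<in> {1..m}" for i
    using measurable_component_singleton[OF that, of "\<lambda>_. std_gauss"]
    by (auto cong: measurable_cong_sets)
  have acc: "rwm_accept m (?R z) (rwm_proposal m \<delta> (?R z) (?R w))
      \<le> (\<Prod>i\<in>{1..m}. exp ((- h * w i / 2) * z i - h\<^sup>2 * (w i)\<^sup>2 / 4))" for z w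
  proof -
    let ?e = "\<Sum>i=1..m. (- h * w i / 2) * z i - h\<^sup>2 * (w i)\<^sup>2 / 4"
    have "1/2 * (\<Sum>i=1..m. (real i)\<^sup>2 * (?R z i)\<^sup>2)
        - 1/2 * (\<Sum>i=1..m. (real i)\<^sup>2 * (?R z i + sqrt (2 * \<delta>) * ?R w i)\<^sup>2)
      = (\<Sum>i=1..m. 2 * ((- h * w i / 2) * z i - h\<^sup>2 * (w i)\<^sup>2 / 4))"
      unfolding sum_distrib_left sum_subtractf[symmetric] h_def[symmetric]
      by (rule sum.cong) (auto simp: power2_eq_square field_simps)
    also have "\<dots> = 2 * ?e" by (simp only: sum_distrib_left)
    finally have "rwm_accept m (?R z) (rwm_proposal m \<delta> (?R z) (?R w)) = min 1 (exp (2 * ?e))"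
      by (simp only: rwm_accept_proposal)
    \<comment> \<open>The square root of the ratio: of all powers in \<open>[0,1]\<close>, the exponent \<open>1/2\<close> gives the least Gaussian mean.\<close>
    also have "\<dots> \<le> exp ?e"
      by (cases "?e \<ge> 0") (auto simp: min_le_iff_disj)
    finally show ?thesis by (simp add: exp_sum)
  qed
  have "(\<integral>\<^sup>+x. \<integral>\<^sup>+\<xi>. ennreal ((\<xi> 1)\<^sup>2 * rwm_accept m x (rwm_proposal m \<delta> x \<xi>))
            \<partial>gauss_target m \<partial>gauss_target m)
      = (\<integral>\<^sup>+z. \<integral>\<^sup>+w. ennreal ((?R w 1)\<^sup>2 * rwm_accept m (?R z) (rwm_proposal m \<delta> (?R z) (?R w)))
            \<partial>?G \<partial>?G)"
  proof -
    note measurable_first_coord[OF m, measurable]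
    have inner: "(\<integral>\<^sup>+\<xi>. ennreal ((\<xi> 1)\<^sup>2 * rwm_accept m x (rwm_proposal m \<delta> x \<xi>)) \<partial>gauss_target m)
      = (\<integral>\<^sup>+w. ennreal ((?R w 1)\<^sup>2 * rwm_accept m x (rwm_proposal m \<delta> x (?R w))) \<partial>?G)"
      if "x \<in> space (state_space m)" for x
    proof -
      have [measurable]: "(\<lambda>_. x) \<in> state_space m \<rightarrow>\<^sub>M state_space m"
        using that by simp
      have [measurable]: "(\<lambda>\<xi>. rwm_accept m x (rwm_proposal m \<delta> x \<xi>)) \<in> borel_measurable (state_space m)"
        by (rule measurable_rwm_accept) measurable
      show ?thesis
        by (rule nn_integral_gauss_target) measurable
    qed
    from nn_integral_gauss_target[OF measurable_mean_weighted_acceptance[OF m]] show ?thesis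
      by (rule trans) (intro nn_integral_cong inner measurable_space[OF measurable_coord_scale])
  qed
  also have "\<dots> \<le> (\<integral>\<^sup>+z. \<integral>\<^sup>+w. ennreal ((w 1)\<^sup>2 *
                 (\<Prod>i\<in>{1..m}. exp ((- h * w i / 2) * z i - h\<^sup>2 * (w i)\<^sup>2 / 4))) \<partial>?G \<partial>?G)"
    using acc m by (intro nn_integral_mono ennreal_leI) (auto intro!: mult_left_mono)
  also have "\<dots> = (\<integral>\<^sup>+w. \<integral>\<^sup>+z. ennreal ((w 1)\<^sup>2 *
                 (\<Prod>i\<in>{1..m}. exp ((- h * w i / 2) * z i - h\<^sup>2 * (w i)\<^sup>2 / 4))) \<partial>?G \<partial>?G)"
  proof (rule GG.Fubini')
    have [measurable]: "(\<lambda>p. fst p i) \<in> borel_measurable (?G \<Otimes>\<^sub>M ?G)"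
      "(\<lambda>p. snd p i) \<in> borel_measurable (?G \<Otimes>\<^sub>M ?G)" if "i \<in> {1..m}" for i
      using coord[OF that] by (auto intro: measurable_compose[OF measurable_fst] measurable_compose[OF measurable_snd])
    note this[OF 1, measurable]
    show "(\<lambda>(w, z). ennreal ((w 1)\<^sup>2 *
        (\<Prod>i\<in>{1..m}. exp ((- h * w i / 2) * z i - h\<^sup>2 * (w i)\<^sup>2 / 4)))) \<in> borel_measurable (?G \<Otimes>\<^sub>M ?G)"
      unfolding split_beta by measurable
  qed
  also have "\<dots> = (\<integral>\<^sup>+w. (\<Prod>i\<in>{1..m}.
        ennreal ((if i = 1 then (w i)\<^sup>2 else 1) * exp (- (\<delta> / 4 * (w i)\<^sup>2)))) \<partial>?G)"
  proof (rule nn_integral_cong)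
    fix w
    have "(\<integral>\<^sup>+z. ennreal ((w 1)\<^sup>2 *
          (\<Prod>i\<in>{1..m}. exp ((- h * w i / 2) * z i - h\<^sup>2 * (w i)\<^sup>2 / 4))) \<partial>?G)
      = (\<integral>\<^sup>+z. ennreal ((w 1)\<^sup>2) *
          (\<Prod>i\<in>{1..m}. ennreal (exp (- h\<^sup>2 * (w i)\<^sup>2 / 4)) * ennreal (exp ((- h * w i / 2) * z i))) \<partial>?G)"
      by (auto simp: ennreal_mult prod_nonneg prod_ennreal[symmetric] mult_exp_exp
            ennreal_mult'[symmetric] algebra_simps intro!: nn_integral_cong prod.cong)
    also have "\<dots> = ennreal ((w 1)\<^sup>2) * (\<integral>\<^sup>+z.
          (\<Prod>i\<in>{1..m}. ennreal (exp (- h\<^sup>2 * (w i)\<^sup>2 / 4)) * ennreal (exp ((- h * w i / 2) * z i))) \<partial>?G)"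
      by (rule nn_integral_cmult) measurable
    also have "\<dots> = ennreal ((w 1)\<^sup>2) * (\<Prod>i\<in>{1..m}. \<integral>\<^sup>+z.
           ennreal (exp (- h\<^sup>2 * (w i)\<^sup>2 / 4)) * ennreal (exp ((- h * w i / 2) * z)) \<partial>std_gauss)"
      by (subst P.product_nn_integral_prod[where f = "\<lambda>i z. ennreal (exp (- h\<^sup>2 * (w i)\<^sup>2 / 4)) * ennreal (exp ((- h * w i / 2) * z))"]) auto
    also have "\<dots> = ennreal ((w 1)\<^sup>2) * (\<Prod>i\<in>{1..m}. ennreal (exp (- (\<delta> / 4 * (w i)\<^sup>2))))"
    proof -
      have "(\<integral>\<^sup>+z. ennreal (exp (- h\<^sup>2 * (w i)\<^sup>2 / 4)) * ennreal (exp ((- h * w i / 2) * z)) \<partial>std_gauss)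
          = ennreal (exp (- (\<delta> / 4 * (w i)\<^sup>2)))" for i
        by (subst nn_integral_cmult, simp, subst nn_integral_std_gauss_exp_linear)
          (simp add: ennreal_mult'[symmetric] mult_exp_exp power_mult_distrib power_divide h2)
      then show ?thesis by simp
    qed
    also have "ennreal ((w 1)\<^sup>2) = (\<Prod>i\<in>{1..m}. ennreal (if i = 1 then (w i)\<^sup>2 else 1))"
      by (subst prod.remove[OF _ 1]) auto
    also have "\<dots> * (\<Prod>i\<in>{1..m}. ennreal (exp (- (\<delta> / 4 * (w i)\<^sup>2)))) =
      (\<Prod>i\<in>{1..m}. ennreal ((if i = 1 then (w i)\<^sup>2 else 1) * exp (- (\<delta> / 4 * (w i)\<^sup>2))))"
      by (simp add: prod.distrib[symmetric] ennreal_mult'')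
    finally show "(\<integral>\<^sup>+z. ennreal ((w 1)\<^sup>2 *
          (\<Prod>i\<in>{1..m}. exp ((- h * w i / 2) * z i - h\<^sup>2 * (w i)\<^sup>2 / 4))) \<partial>?G) =
      (\<Prod>i\<in>{1..m}. ennreal ((if i = 1 then (w i)\<^sup>2 else 1) * exp (- (\<delta> / 4 * (w i)\<^sup>2))))" .
  qed
  also have "\<dots> = (\<Prod>i\<in>{1..m}. \<integral>\<^sup>+w.
        ennreal ((if i = 1 then w\<^sup>2 else 1) * exp (- (\<delta> / 4 * w\<^sup>2))) \<partial>std_gauss)"
    by (subst P.product_nn_integral_prod[where
          f = "\<lambda>i w. ennreal ((if i = 1 then w\<^sup>2 else 1) * exp (- (\<delta> / 4 * w\<^sup>2)))"]) auto
  also have "\<dots> = (\<integral>\<^sup>+w. ennreal (w\<^sup>2 * exp (- (\<delta> / 4 * w\<^sup>2))) \<partial>std_gauss)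
      * ennreal ((1 + \<delta> / 2) powr (- 1/2)) ^ (m - 1)"
  proof -
    have "card ({1..m} - {1}) = m - 1"
      by (simp add: card_Diff_singleton[OF 1] del: One_nat_def)
    then show ?thesis
      using nn_integral_std_gauss_exp_neg_square[of "\<delta> / 4"] \<delta>
      by (subst prod.remove[OF _ 1]) (auto simp del: One_nat_def)
  qed
  also have "\<dots> \<le> 1 * ennreal ((1 + \<delta> / 2) powr (- 1/2)) ^ (m - 1)"
  proof (rule mult_right_mono)
    have "(\<integral>\<^sup>+w. ennreal (w\<^sup>2 * exp (- (\<delta> / 4 * w\<^sup>2))) \<partial>std_gauss)
        \<le> (\<integral>\<^sup>+w. ennreal (w\<^sup>2) \<partial>std_gauss)"
      using \<delta> by (intro nn_integral_mono ennreal_leI mult_right_le_one_le) auto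
    then show "(\<integral>\<^sup>+w. ennreal (w\<^sup>2 * exp (- (\<delta> / 4 * w\<^sup>2))) \<partial>std_gauss) \<le> 1"
      by (simp add: nn_integral_std_gauss_square)
  qed simp
  also have "\<dots> = ennreal ((1 + \<delta> / 2) powr (- (real m - 1) / 2))"
  proof -
    have eq: "- 1/2 * real (m - 1) = - (real m - 1) / 2" using m by (simp add: of_nat_diff field_simps)
    have "ennreal ((1 + \<delta> / 2) powr (- 1/2)) ^ (m - 1)
        = ennreal ((1 + \<delta> / 2) powr (- 1/2 * real (m - 1)))"
      using \<delta> by (simp add: ennreal_power powr_power del: One_nat_def)
    then show ?thesis by (simp only: eq mult_1_left)
  qed
  finally show ?thesis .
qed

section \<open>Displacement of the first coordinate in one step\<close>

text \<open>The non-integrable case holds because the integral is then \<open>0\<close> by convention.\<close>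

lemma square_integral_le:
  fixes X :: "'a \<Rightarrow> real"
  assumes "prob_space M" and [measurable]: "X \<in> borel_measurable M"
  shows "ennreal ((\<integral>x. X x \<partial>M)\<^sup>2) \<le> (\<integral>\<^sup>+x. ennreal ((X x)\<^sup>2) \<partial>M)"
proof (cases "integrable M X")
  case True
  interpret prob_space M by fact
  have "ennreal ((\<integral>x. X x \<partial>M)\<^sup>2) = (ennreal (norm (\<integral>x. X x \<partial>M)))\<^sup>2"
    by (simp add: ennreal_power)
  also have "\<dots> \<le> (\<integral>\<^sup>+x. ennreal (norm (X x)) * 1 \<partial>M)\<^sup>2"
    using integral_norm_bound_ennreal[OF True] by (intro power_mono) auto
  also have "\<dots> \<le> (\<integral>\<^sup>+x. (ennreal (norm (X x)))\<^sup>2 \<partial>M) * (\<integral>\<^sup>+x. 1\<^sup>2 \<partial>M)"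
    by (rule Cauchy_Schwarz_nn_integral) auto
  also have "\<dots> = (\<integral>\<^sup>+x. ennreal ((X x)\<^sup>2) \<partial>M)"
    by (simp add: ennreal_power emeasure_space_1)
  finally show ?thesis .
qed (simp add: not_integrable_integral_eq)

abbreviation unit_uniform :: "real measure" where
  "unit_uniform \<equiv> uniform_measure lborel {0..1}"

lemma prob_space_unit_uniform: "prob_space unit_uniform"
  by (rule prob_space_uniform_measure) auto

lemma nn_integral_uniform_threshold:
  fixes \<alpha> :: real
  assumes "0 \<le> \<alpha>" "\<alpha> \<le> 1"
  shows "(\<integral>\<^sup>+u. (if u \<le> \<alpha> then c else 0) \<partial>unit_uniform) = c * ennreal \<alpha>"
proof -
  have "(\<integral>\<^sup>+u. (if u \<le> \<alpha> then c else 0) \<partial>unit_uniform)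
      = (\<integral>\<^sup>+u. c * indicator {..\<alpha>} u \<partial>unit_uniform)"
    by (rule nn_integral_cong) auto
  also have "\<dots> = c * emeasure unit_uniform {..\<alpha>}"
    by (rule nn_integral_cmult_indicator) simp
  also have "{0..1} \<inter> {..\<alpha>} = {0..\<alpha>}" using assms by auto
  then have "emeasure unit_uniform {..\<alpha>} = ennreal \<alpha>"
    using assms by (simp add: divide_ennreal_def)
  finally show ?thesis .
qed

lemma measurable_rwm_step:
  assumes "x \<in> space (state_space m)"
  shows "(\<lambda>(\<xi>, u). if u \<le> rwm_accept m x (rwm_proposal m \<delta> x \<xi>) then rwm_proposal m \<delta> x \<xi> else x)
    \<in> gauss_target m \<Otimes>\<^sub>M unit_uniform \<rightarrow>\<^sub>M state_space m"
proof -
  have [measurable]: "(\<lambda>_. x) \<in> gauss_target m \<Otimes>\<^sub>M unit_uniform \<rightarrow>\<^sub>M state_space m"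
    using assms by simp
  have [measurable]: "(\<lambda>p. rwm_accept m x (rwm_proposal m \<delta> x (fst p)))
      \<in> borel_measurable (gauss_target m \<Otimes>\<^sub>M unit_uniform)"
    by (rule measurable_rwm_accept) measurable
  have [measurable]: "(\<lambda>p. rwm_proposal m \<delta> x (fst p)) \<in> gauss_target m \<Otimes>\<^sub>M unit_uniform \<rightarrow>\<^sub>M state_space m"
    by (rule measurable_rwm_proposal) measurable
  show ?thesis unfolding split_beta by measurable
qed

lemma markov_op_rwm_first_coord:
  assumes m: "m \<ge> 1" and x: "x \<in> space (state_space m)"
  shows "markov_op (rwm_kernel m \<delta>) (\<lambda>y. y 1) x =
    (\<integral>\<omega>. x 1 + (if snd \<omega> \<le> rwm_accept m x (rwm_proposal m \<delta> x (fst \<omega>))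
            then sqrt (2 * \<delta>) * fst \<omega> 1 else 0) \<partial>(gauss_target m \<Otimes>\<^sub>M unit_uniform))"
proof -
  have "markov_op (rwm_kernel m \<delta>) (\<lambda>y. y 1) x = (\<integral>\<omega>. (case \<omega> of (\<xi>, u) \<Rightarrow>
      if u \<le> rwm_accept m x (rwm_proposal m \<delta> x \<xi>) then rwm_proposal m \<delta> x \<xi> else x) 1
      \<partial>(gauss_target m \<Otimes>\<^sub>M unit_uniform))"
    unfolding markov_op_def rwm_kernel_def
    by (rule integral_distr[OF measurable_rwm_step[OF x] measurable_first_coord[OF m]])
  also have "\<dots> = (\<integral>\<omega>. x 1 + (if snd \<omega> \<le> rwm_accept m x (rwm_proposal m \<delta> x (fst \<omega>))
            then sqrt (2 * \<delta>) * fst \<omega> 1 else 0) \<partial>(gauss_target m \<Otimes>\<^sub>M unit_uniform))"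
  proof (rule Bochner_Integration.integral_cong[OF refl])
    have "rwm_proposal m \<delta> x \<xi> 1 = x 1 + sqrt (2 * \<delta>) * \<xi> 1" for \<xi>
      using m by (simp add: rwm_proposal_def)
    then show "(case \<omega> of (\<xi>, u) \<Rightarrow>
        if u \<le> rwm_accept m x (rwm_proposal m \<delta> x \<xi>) then rwm_proposal m \<delta> x \<xi> else x) 1
      = x 1 + (if snd \<omega> \<le> rwm_accept m x (rwm_proposal m \<delta> x (fst \<omega>))
            then sqrt (2 * \<delta>) * fst \<omega> 1 else 0)" for \<omega>
      by (cases \<omega>) simp
  qed
  finally show ?thesis .
qed

lemma measurable_markov_op_rwm_first_coord:
  assumes m: "m \<ge> 1"
  shows "markov_op (rwm_kernel m \<delta>) (\<lambda>y. y 1) \<in> borel_measurable (state_space m)"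
proof -
  interpret T: prob_space "gauss_target m" by (rule prob_space_gauss_target)
  interpret U: prob_space unit_uniform by (rule prob_space_unit_uniform)
  interpret TU: pair_prob_space "gauss_target m" unit_uniform ..
  let ?M = "state_space m \<Otimes>\<^sub>M (gauss_target m \<Otimes>\<^sub>M unit_uniform)"
  have [measurable]: "(\<lambda>p. fst p 1) \<in> borel_measurable ?M" "(\<lambda>p. fst (snd p) 1) \<in> borel_measurable ?M"
    by (rule measurable_compose[OF measurable_fst measurable_first_coord[OF m]]
        measurable_compose[OF measurable_compose[OF measurable_snd measurable_fst]
          measurable_first_coord_gauss_target[OF m]])+
  have [measurable]: "(\<lambda>p. rwm_accept m (fst p) (rwm_proposal m \<delta> (fst p) (fst (snd p)))) \<in> borel_measurable ?M"
    by (rule measurable_rwm_accept) measurable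
  have "(\<lambda>x. \<integral>\<omega>. x 1 + (if snd \<omega> \<le> rwm_accept m x (rwm_proposal m \<delta> x (fst \<omega>))
            then sqrt (2 * \<delta>) * fst \<omega> 1 else 0) \<partial>(gauss_target m \<Otimes>\<^sub>M unit_uniform))
      \<in> borel_measurable (state_space m)"
    by (rule TU.borel_measurable_lebesgue_integral, unfold split_beta) measurable
  then show ?thesis
    by (subst measurable_cong[OF markov_op_rwm_first_coord[OF m]])
qed

lemma first_coord_moments:
  assumes m: "m \<ge> 1"
  shows "integrable (gauss_target m) (\<lambda>x. x 1)"
    and "integrable (gauss_target m) (\<lambda>x. (x 1)\<^sup>2)"
    and "(\<integral>x. x 1 \<partial>gauss_target m) = 0"
    and "(\<integral>x. (x 1)\<^sup>2 \<partial>gauss_target m) = 1"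
proof -
  have [measurable]: "(\<lambda>x. x 1) \<in> gauss_target m \<rightarrow>\<^sub>M borel"
    by (rule measurable_first_coord_gauss_target[OF m])
  have tr: "integrable (gauss_target m) (\<lambda>x. f (x 1)) \<longleftrightarrow> integrable lborel (\<lambda>t. std_normal_density t * f t)"
    "(\<integral>x. f (x 1) \<partial>gauss_target m) = (\<integral>t. std_normal_density t * f t \<partial>lborel)"
    if [measurable]: "f \<in> borel_measurable borel" for f :: "real \<Rightarrow> real"
    using integrable_distr_eq[of "\<lambda>x. x 1" "gauss_target m" borel f]
          integral_distr[of "\<lambda>x. x 1" "gauss_target m" borel f]
    by (auto simp: distr_gauss_target_first[OF m] integrable_density integral_density
          simp del: One_nat_def)
  show "integrable (gauss_target m) (\<lambda>x. x 1)"
    using tr(1)[of "\<lambda>t. t"] integrable_std_normal_moment[of 1] by simp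
  show "integrable (gauss_target m) (\<lambda>x. (x 1)\<^sup>2)"
    using tr(1)[of "\<lambda>t. t\<^sup>2"] integrable_std_normal_moment[of 2] by simp
  show "(\<integral>x. x 1 \<partial>gauss_target m) = 0"
    using tr(2)[of "\<lambda>t. t"] integral_std_normal_moment_odd[of 0] by simp
  show "(\<integral>x. (x 1)\<^sup>2 \<partial>gauss_target m) = 1"
    using tr(2)[of "\<lambda>t. t\<^sup>2"] integral_std_normal_moment_even[of 1] by (simp add: fact_numeral)
qed

text \<open>
  The first coordinate moves by \<open>sqrt (2 * \<delta>) * \<xi> 1\<close> when the proposal is accepted and not at all
  otherwise; by Jensen's inequality the square of the mean move is at most the mean square, and
  integrating out the uniform variable replaces the acceptance event by its probability.
\<close>

lemma square_displacement_le:
  assumes m: "m \<ge> 1" and \<delta>: "\<delta> > 0" and x: "x \<in> space (state_space m)"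
  shows "ennreal ((markov_op (rwm_kernel m \<delta>) (\<lambda>y. y 1) x - x 1)\<^sup>2) \<le>
    ennreal (2 * \<delta>) * (\<integral>\<^sup>+\<xi>. ennreal ((\<xi> 1)\<^sup>2 * rwm_accept m x (rwm_proposal m \<delta> x \<xi>)) \<partial>gauss_target m)"
proof -
  interpret T: prob_space "gauss_target m" by (rule prob_space_gauss_target)
  interpret U: prob_space unit_uniform by (rule prob_space_unit_uniform)
  interpret TU: pair_prob_space "gauss_target m" unit_uniform ..
  note measurable_first_coord_gauss_target[OF m, measurable]
  let ?\<alpha> = "\<lambda>\<xi>. rwm_accept m x (rwm_proposal m \<delta> x \<xi>)"
  let ?D = "\<lambda>\<omega>. if snd \<omega> \<le> ?\<alpha> (fst \<omega>) then sqrt (2 * \<delta>) * fst \<omega> 1 else 0"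
  have \<alpha>: "0 \<le> ?\<alpha> \<xi>" "?\<alpha> \<xi> \<le> 1" for \<xi> by (auto simp: rwm_accept_def)
  have \<alpha>_meas [measurable]: "?\<alpha> \<in> borel_measurable (gauss_target m)"
    by (rule measurable_rwm_accept) (use x in simp, measurable)
  have [measurable]: "(\<lambda>p. ?\<alpha> (fst p)) \<in> borel_measurable (gauss_target m \<Otimes>\<^sub>M unit_uniform)"
    by (rule measurable_compose[OF measurable_fst \<alpha>_meas])
  have first [measurable]: "(\<lambda>p. fst p 1) \<in> borel_measurable (gauss_target m \<Otimes>\<^sub>M unit_uniform)"
    by (rule measurable_compose[OF measurable_fst measurable_first_coord_gauss_target[OF m]])
  have D [measurable]: "?D \<in> borel_measurable (gauss_target m \<Otimes>\<^sub>M unit_uniform)"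
    by measurable
  have D2: "(\<integral>\<^sup>+\<omega>. ennreal ((?D \<omega>)\<^sup>2) \<partial>(gauss_target m \<Otimes>\<^sub>M unit_uniform))
     = ennreal (2 * \<delta>) * (\<integral>\<^sup>+\<xi>. ennreal ((\<xi> 1)\<^sup>2 * ?\<alpha> \<xi>) \<partial>gauss_target m)"
  proof -
    have "(\<integral>\<^sup>+\<omega>. ennreal ((?D \<omega>)\<^sup>2) \<partial>(gauss_target m \<Otimes>\<^sub>M unit_uniform))
      = (\<integral>\<^sup>+\<xi>. \<integral>\<^sup>+u. ennreal ((?D (\<xi>, u))\<^sup>2) \<partial>unit_uniform \<partial>gauss_target m)"
      by (subst U.nn_integral_fst[symmetric]) auto
    also have "\<dots> = (\<integral>\<^sup>+\<xi>. \<integral>\<^sup>+u. (if u \<le> ?\<alpha> \<xi> then ennreal (2 * \<delta> * (\<xi> 1)\<^sup>2) else 0)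
                       \<partial>unit_uniform \<partial>gauss_target m)"
      using \<delta> by (intro nn_integral_cong) (auto simp: power_mult_distrib)
    also have "\<dots> = (\<integral>\<^sup>+\<xi>. ennreal (2 * \<delta>) * ennreal ((\<xi> 1)\<^sup>2 * ?\<alpha> \<xi>) \<partial>gauss_target m)"
      using \<delta> \<alpha> by (simp add: nn_integral_uniform_threshold ennreal_mult'[symmetric] ennreal_mult''[symmetric] mult.assoc)
    also have "\<dots> = ennreal (2 * \<delta>) * (\<integral>\<^sup>+\<xi>. ennreal ((\<xi> 1)\<^sup>2 * ?\<alpha> \<xi>) \<partial>gauss_target m)"
      by (rule nn_integral_cmult) measurable
    finally show ?thesis .
  qed
  have "integrable (gauss_target m \<Otimes>\<^sub>M unit_uniform) (\<lambda>\<omega>. fst \<omega> 1)"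
    using first_coord_moments(1)[OF m]
    by (intro TU.Fubini_integrable) auto
  then have D_int: "integrable (gauss_target m \<Otimes>\<^sub>M unit_uniform) ?D"
    by (rule Bochner_Integration.integrable_bound[OF integrable_mult_right[of "sqrt (2 * \<delta>)"] D]) auto
  have "markov_op (rwm_kernel m \<delta>) (\<lambda>y. y 1) x - x 1
      = (\<integral>\<omega>. ?D \<omega> \<partial>(gauss_target m \<Otimes>\<^sub>M unit_uniform))"
    unfolding markov_op_rwm_first_coord[OF m x]
    by (subst Bochner_Integration.integral_add[OF _ D_int]) (simp_all add: TU.prob_space)
  then show ?thesis
    using square_integral_le[OF TU.prob_space_axioms D] D2 by simp
qed

lemma L2_norm_displacement_le:
  assumes m: "m \<ge> 1" and \<delta>: "\<delta> > 0"
  defines "D \<equiv> \<lambda>x. markov_op (rwm_kernel m \<delta>) (\<lambda>y. y 1) x - x 1"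
  shows "D \<in> L2 (gauss_target m)"
    and "L2_norm (gauss_target m) D
           \<le> sqrt (2 * \<delta> * (1 + \<delta> / 2) powr (- (real m - 1) / 2))"
proof -
  have D [measurable]: "D \<in> borel_measurable (gauss_target m)"
  proof -
    have "markov_op (rwm_kernel m \<delta>) (\<lambda>y. y 1) \<in> borel_measurable (gauss_target m)"
      using measurable_markov_op_rwm_first_coord[OF m]
      unfolding measurable_cong_sets[OF sets_gauss_target refl] .
    from borel_measurable_diff[OF this measurable_first_coord_gauss_target[OF m]]
    show ?thesis unfolding D_def .
  qed
  let ?B = "2 * \<delta> * (1 + \<delta> / 2) powr (- (real m - 1) / 2)"
  have "(\<integral>\<^sup>+x. ennreal ((D x)\<^sup>2) \<partial>gauss_target m) \<le> (\<integral>\<^sup>+x. ennreal (2 * \<delta>) *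
    (\<integral>\<^sup>+\<xi>. ennreal ((\<xi> 1)\<^sup>2 * rwm_accept m x (rwm_proposal m \<delta> x \<xi>)) \<partial>gauss_target m) \<partial>gauss_target m)"
    unfolding D_def
    by (intro nn_integral_mono square_displacement_le[OF m \<delta>]) (simp add: space_gauss_target)
  also have "\<dots> = ennreal (2 * \<delta>) * (\<integral>\<^sup>+x. \<integral>\<^sup>+\<xi>. ennreal ((\<xi> 1)\<^sup>2 *
      rwm_accept m x (rwm_proposal m \<delta> x \<xi>)) \<partial>gauss_target m \<partial>gauss_target m)"
    by (rule nn_integral_cmult, subst measurable_cong_sets[OF sets_gauss_target refl])
      (rule measurable_mean_weighted_acceptance[OF m])
  also have "\<dots> \<le> ennreal (2 * \<delta>) * ennreal ((1 + \<delta> / 2) powr (- (real m - 1) / 2))"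
    by (intro mult_left_mono expected_weighted_acceptance[OF m \<delta>]) simp
  also have "\<dots> = ennreal ?B"
    using \<delta> by (subst ennreal_mult[symmetric]) auto
  finally have le: "(\<integral>\<^sup>+x. ennreal ((D x)\<^sup>2) \<partial>gauss_target m) \<le> ennreal ?B" .
  have int: "integrable (gauss_target m) (\<lambda>x. (D x)\<^sup>2)"
  proof (rule integrableI_nonneg)
    show "(\<integral>\<^sup>+x. ennreal ((D x)\<^sup>2) \<partial>gauss_target m) < \<infinity>"
      using le by (rule le_less_trans) simp
  qed (use borel_measurable_power[OF D, of 2] in simp_all)
  with D show "D \<in> L2 (gauss_target m)" by (simp add: L2_def)
  have "(\<integral>x. (D x)\<^sup>2 \<partial>gauss_target m) \<le> ?B"
  proof -
    have "(\<integral>\<^sup>+x. ennreal ((D x)\<^sup>2) \<partial>gauss_target m) = ennreal (\<integral>x. (D x)\<^sup>2 \<partial>gauss_target m)"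
      by (rule nn_integral_eq_integral[OF int]) simp
    with le have "ennreal (\<integral>x. (D x)\<^sup>2 \<partial>gauss_target m) \<le> ennreal ?B" by (simp only:)
    then show ?thesis using \<delta> by (subst (asm) ennreal_le_iff) auto
  qed
  then show "L2_norm (gauss_target m) D \<le> sqrt ?B"
    unfolding L2_norm_def by simp
qed

section \<open>Spectral gap and displacement\<close>

lemma L2_norm_triangle:
  assumes "f \<in> L2 M" "g \<in> L2 M"
  shows "(\<lambda>x. f x + g x) \<in> L2 M" and "L2_norm M (\<lambda>x. f x + g x) \<le> L2_norm M f + L2_norm M g"
proof -
  have [measurable]: "f \<in> borel_measurable M" "g \<in> borel_measurable M"
    and f: "integrable M (\<lambda>x. (f x)\<^sup>2)" and g: "integrable M (\<lambda>x. (g x)\<^sup>2)"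
    using assms by (auto simp: L2_def)
  have fg: "integrable M (\<lambda>x. \<bar>f x\<bar> * \<bar>g x\<bar>)"
  proof (rule Bochner_Integration.integrable_bound[OF Bochner_Integration.integrable_add[OF f g]])
    show "AE x in M. norm (\<bar>f x\<bar> * \<bar>g x\<bar>) \<le> norm ((f x)\<^sup>2 + (g x)\<^sup>2)"
    proof (rule AE_I2)
      fix x
      have "0 \<le> (\<bar>f x\<bar> - \<bar>g x\<bar>)\<^sup>2" by simp
      then have "2 * (\<bar>f x\<bar> * \<bar>g x\<bar>) \<le> (f x)\<^sup>2 + (g x)\<^sup>2" by (simp add: power2_diff)
      moreover have "0 \<le> \<bar>f x\<bar> * \<bar>g x\<bar>" by simp
      ultimately have "\<bar>f x\<bar> * \<bar>g x\<bar> \<le> (f x)\<^sup>2 + (g x)\<^sup>2" by linarith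
      then show "norm (\<bar>f x\<bar> * \<bar>g x\<bar>) \<le> norm ((f x)\<^sup>2 + (g x)\<^sup>2)" by (simp add: abs_mult)
    qed
  qed measurable
  have bound: "integrable M (\<lambda>x. (f x)\<^sup>2 + (g x)\<^sup>2 + 2 * (\<bar>f x\<bar> * \<bar>g x\<bar>))"
    using f g fg by auto
  have ptw: "(f x + g x)\<^sup>2 \<le> (f x)\<^sup>2 + (g x)\<^sup>2 + 2 * (\<bar>f x\<bar> * \<bar>g x\<bar>)" for x
    using abs_ge_self[of "f x * g x"] by (simp add: power2_sum abs_mult)
  have int: "integrable M (\<lambda>x. (f x + g x)\<^sup>2)"
    by (rule Bochner_Integration.integrable_bound[OF bound]) (auto intro: order_trans[OF ptw])
  then show "(\<lambda>x. f x + g x) \<in> L2 M" by (simp add: L2_def)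
  let ?f = "L2_norm M f" and ?g = "L2_norm M g"
  have "ennreal ((\<integral>x. \<bar>f x\<bar> * \<bar>g x\<bar> \<partial>M)\<^sup>2) = (\<integral>\<^sup>+x. ennreal \<bar>f x\<bar> * ennreal \<bar>g x\<bar> \<partial>M)\<^sup>2"
    using nn_integral_eq_integral[OF fg] by (simp add: ennreal_power ennreal_mult)
  also have "\<dots> \<le> (\<integral>\<^sup>+x. (ennreal \<bar>f x\<bar>)\<^sup>2 \<partial>M) * (\<integral>\<^sup>+x. (ennreal \<bar>g x\<bar>)\<^sup>2 \<partial>M)"
    by (rule Cauchy_Schwarz_nn_integral) auto
  also have "\<dots> = ennreal ((?f * ?g)\<^sup>2)"
    using nn_integral_eq_integral[OF f] nn_integral_eq_integral[OF g]
    by (simp add: ennreal_power ennreal_mult L2_norm_def power_mult_distrib)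
  finally have "(\<integral>x. \<bar>f x\<bar> * \<bar>g x\<bar> \<partial>M)\<^sup>2 \<le> (?f * ?g)\<^sup>2" by (simp add: ennreal_le_iff)
  then have cs: "(\<integral>x. \<bar>f x\<bar> * \<bar>g x\<bar> \<partial>M) \<le> ?f * ?g"
    by (rule power2_le_imp_le) (simp add: L2_norm_def)
  have "(\<integral>x. (f x + g x)\<^sup>2 \<partial>M) \<le> (\<integral>x. (f x)\<^sup>2 + (g x)\<^sup>2 + 2 * (\<bar>f x\<bar> * \<bar>g x\<bar>) \<partial>M)"
    by (intro integral_mono int bound ptw)
  also have "\<dots> = ?f\<^sup>2 + ?g\<^sup>2 + 2 * (\<integral>x. \<bar>f x\<bar> * \<bar>g x\<bar> \<partial>M)"
    using f g fg by (simp add: L2_norm_def)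
  also have "\<dots> \<le> (?f + ?g)\<^sup>2" using cs by (simp add: power2_sum)
  finally show "L2_norm M (\<lambda>x. f x + g x) \<le> ?f + ?g"
    unfolding L2_norm_def[of M "\<lambda>x. f x + g x"]
    by (intro real_le_lsqrt) (auto simp: L2_norm_def)
qed

text \<open>
  By the triangle inequality, a function that the operator hardly moves keeps almost all of its
  distance from the constants, so the ratio defining \<open>\<beta>\<close> is close to \<open>1\<close> for it.
\<close>

lemma L2_spectral_gap_le_displacement:
  fixes f :: "'a \<Rightarrow> real"
  assumes "prob_space \<mu>" and f: "f \<in> L2 \<mu>" and D: "(\<lambda>x. markov_op P f x - f x) \<in> L2 \<mu>"
    and pos: "L2_norm \<mu> (\<lambda>x. f x - (\<integral>y. f y \<partial>\<mu>)) > 0"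
  shows "L2_spectral_gap \<mu> P
    \<le> ereal (L2_norm \<mu> (\<lambda>x. markov_op P f x - f x) / L2_norm \<mu> (\<lambda>x. f x - (\<integral>y. f y \<partial>\<mu>)))"
proof -
  interpret prob_space \<mu> by fact
  let ?c = "\<integral>y. f y \<partial>\<mu>"
  let ?D = "\<lambda>x. markov_op P f x - f x"
  let ?p = "L2_norm \<mu> (\<lambda>x. markov_op P f x - ?c)" and ?d = "L2_norm \<mu> ?D"
    and ?v = "L2_norm \<mu> (\<lambda>x. f x - ?c)"
  have const: "(\<lambda>_. c) \<in> L2 \<mu>" for c by (simp add: L2_def)
  have neg: "(\<lambda>x. - ?D x) \<in> L2 \<mu>" and neg_norm: "L2_norm \<mu> (\<lambda>x. - ?D x) = ?d"
    using D borel_measurable_uminus[of ?D \<mu>] by (auto simp: L2_def L2_norm_def power2_commute)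
  have "(\<lambda>x. (f x + ?D x) + - ?c) \<in> L2 \<mu>"
    by (intro L2_norm_triangle(1) f D const)
  then have "(\<lambda>x. markov_op P f x - ?c) \<in> L2 \<mu>" by simp
  from L2_norm_triangle(2)[OF this neg] have "?v \<le> ?p + ?d"
    by (simp add: neg_norm[simplified])
  then have "?v / ?v \<le> (?p + ?d) / ?v" using pos by (intro divide_right_mono) auto
  then have "1 - ?d / ?v \<le> ?p / ?v" using pos by (simp add: add_divide_distrib)
  moreover have "ereal (?p / ?v) \<le> L2_beta \<mu> P"
    unfolding L2_beta_def
  proof (rule SUP_upper, safe)
    fix c assume c: "AE x in \<mu>. f x = c"
    have "?c = (\<integral>y. c \<partial>\<mu>)"
      using c f by (intro integral_cong_AE) (auto simp: L2_def)
    then have "AE x in \<mu>. (f x - ?c)\<^sup>2 = 0" using c by (auto simp: prob_space)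
    then have "(\<integral>x. (f x - ?c)\<^sup>2 \<partial>\<mu>) = 0" by (rule integral_eq_zero_AE)
    with pos show False by (simp add: L2_norm_def)
  qed (rule f)
  ultimately have "ereal (1 - ?d / ?v) \<le> L2_beta \<mu> P"
    by (meson ereal_less_eq(3) order_trans)
  then have "L2_spectral_gap \<mu> P \<le> 1 - ereal (1 - ?d / ?v)"
    unfolding L2_spectral_gap_def by (intro ereal_minus_mono) auto
  then show ?thesis by (simp add: one_ereal_def)
qed

text \<open>
  The first coordinate is a test function with mean \<open>0\<close> and variance \<open>1\<close>, so its displacement in \<open>L\<^sup>2\<close>
  bounds the gap. The factor \<open>2 * \<delta>\<close> comes from the size of the proposed moves, the power of
  \<open>1 + \<delta> / 2\<close> from their being accepted rarely.
\<close>

lemma rwm_spectral_gap_le: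
  assumes m: "m \<ge> 1" and \<delta>: "\<delta> > 0"
  shows "L2_spectral_gap (gauss_target m) (rwm_kernel m \<delta>)
    \<le> ereal (sqrt (2 * \<delta> * (1 + \<delta> / 2) powr (- (real m - 1) / 2)))"
proof -
  note mom = first_coord_moments[OF m]
  have f: "(\<lambda>x. x 1) \<in> L2 (gauss_target m)"
    using mom(1,2) by (auto simp: L2_def)
  have v: "L2_norm (gauss_target m) (\<lambda>x. x 1 - (\<integral>y. y 1 \<partial>gauss_target m)) = 1"
    using mom(3,4) by (simp add: L2_norm_def)
  show ?thesis
    using L2_spectral_gap_le_displacement[OF prob_space_gauss_target f L2_norm_displacement_le(1)[OF m \<delta>]]
      L2_norm_displacement_le(2)[OF m \<delta>]
    unfolding v by (simp add: order_trans)
qed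

section \<open>Asymptotics in the dimension\<close>

lemma superpolynomial_decay:
  fixes c r q :: real
  assumes "c > 0" "r > 0"
  shows "\<exists>K. \<forall>m::nat\<ge>1. exp (- c * real m powr r) \<le> K * real m powr (- q)"
proof -
  have "(\<lambda>m::nat. exp (- c * real m powr r) * real m powr q) \<longlonglongrightarrow> 0"
    using assms by real_asymp
  then have "Bseq (\<lambda>m::nat. exp (- c * real m powr r) * real m powr q)"
    by (intro convergent_imp_Bseq convergentI)
  then obtain K where K: "\<And>m::nat. norm (exp (- c * real m powr r) * real m powr q) \<le> K"
    unfolding Bseq_def by blast
  have "exp (- c * real m powr r) \<le> K * real m powr (- q)" if "m \<ge> 1" for m :: nat
    using K[of m] that by (simp add: powr_minus field_simps)
  then show ?thesis by blast
qed

text \<open>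
  With \<open>\<delta> = s * m powr (- a)\<close> the logarithm of the power is of order \<open>- m * \<delta>\<close>, that is, of order
  \<open>- m powr (1 - a)\<close>, because \<open>ln (1 + t) \<ge> t / (1 + t)\<close> is of order \<open>t\<close> on the bounded range of \<open>\<delta> / 2\<close>.
\<close>

lemma rwm_gap_bound_superpolynomial:
  fixes s a p :: real
  assumes s: "s > 0" and a: "0 \<le> a" "a < 1"
  shows "\<exists>K. \<forall>m::nat\<ge>1. sqrt (2 * (s * real m powr (- a)) *
            (1 + (s * real m powr (- a)) / 2) powr (- (real m - 1) / 2)) \<le> K * real m powr (- p)"
proof -
  \<comment> \<open>The rate of decay: \<open>8 = 2 * 2 * 2\<close> collects the halves in \<open>\<delta> / 2\<close>, in the exponent and in the square root.\<close>
  define c where "c = s / (8 * (1 + s / 2))"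
  have c: "c > 0" using s by (simp add: c_def)
  obtain K where K: "\<And>m::nat. m \<ge> 1 \<Longrightarrow> exp (- c * real m powr (1 - a)) \<le> K * real m powr (- p)"
    using superpolynomial_decay[OF c, of "1 - a" p] a by auto
  have "sqrt (2 * (s * real m powr (- a)) * (1 + (s * real m powr (- a)) / 2) powr (- (real m - 1) / 2))
          \<le> (sqrt (2 * s) * exp (2 * c) * K) * real m powr (- p)" if m: "m \<ge> 1" for m :: nat
  proof -
    define d where "d = s * real m powr (- a)"
    have le1: "real m powr (- a) \<le> 1" using m a by (simp add: powr_le_one_le powr_minus inverse_le_1_iff ge_one_powr_ge_zero)
    have d: "0 < d" "d \<le> s" using m s le1 by (auto simp: d_def)
    have "4 * c * real m powr (- a) = (d / 2) / (1 + s / 2)" using s by (simp add: c_def d_def field_simps)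
    also have "\<dots> \<le> (d / 2) / (1 + d / 2)" using d by (intro divide_left_mono) auto
    also have "\<dots> \<le> ln (1 + d / 2)"
      using ln_le_minus_one[of "1 / (1 + d/2)"] d by (simp add: ln_div field_simps)
    finally have ln_ge: "4 * c * real m powr (- a) \<le> ln (1 + d / 2)" .
    define L where "L = ln (1 + d / 2) * (real m - 1)"
    have "4 * c * real m powr (- a) * (real m - 1) \<le> L"
      unfolding L_def using m ln_ge by (intro mult_right_mono) auto
    also have "4 * c * real m powr (- a) * (real m - 1)
        = 4 * (c * real m powr (1 - a)) - 4 * (c * real m powr (- a))"
      using m powr_add[of "real m" "- a" 1] by (simp add: algebra_simps)
    finally have "4 * (c * real m powr (1 - a)) - 4 * (c * real m powr (- a)) \<le> L" .
    moreover have "c * real m powr (- a) \<le> c" using c le1 by simp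
    ultimately have "- L / 2 \<le> 2 * (2 * c - c * real m powr (1 - a))"
      using c by argo
    moreover have "- (real m - 1) / 2 * ln (1 + d / 2) = - L / 2"
      by (simp add: L_def algebra_simps)
    ultimately have "- (real m - 1) / 2 * ln (1 + d / 2) \<le> 2 * (2 * c - c * real m powr (1 - a))"
      by simp
    then have "(1 + d / 2) powr (- (real m - 1) / 2) \<le> exp (2 * (2 * c - c * real m powr (1 - a)))"
      using d by (simp add: powr_def)
    also have "\<dots> = (exp (2 * c - c * real m powr (1 - a)))\<^sup>2" by (rule exp_double)
    finally have "2 * d * (1 + d / 2) powr (- (real m - 1) / 2)
        \<le> 2 * s * (exp (2 * c - c * real m powr (1 - a)))\<^sup>2"
      using d by (intro mult_mono) auto
    then have "sqrt (2 * d * (1 + d / 2) powr (- (real m - 1) / 2))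
        \<le> sqrt (2 * s * (exp (2 * c - c * real m powr (1 - a)))\<^sup>2)"
      by (rule real_sqrt_le_mono)
    also have "\<dots> = sqrt (2 * s) * exp (2 * c) * exp (- c * real m powr (1 - a))"
      by (simp add: real_sqrt_mult exp_add[symmetric])
    also have "\<dots> \<le> sqrt (2 * s) * exp (2 * c) * (K * real m powr (- p))"
      using K[OF m] s by (intro mult_left_mono) auto
    finally show ?thesis by (simp add: d_def mult.assoc)
  qed
  then show ?thesis by blast
qed

theorem theorem2p17:
  fixes s :: real
  assumes "s > 0"
  shows "(\<forall>a\<ge>0. a < 1 \<longrightarrow> (\<forall>p>0. \<exists>K::real. \<forall>m::nat\<ge>1.
            L2_spectral_gap (gauss_target m) (rwm_kernel m (s * real m powr (- a)))
              \<le> ereal (K * real m powr (- p))))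
       \<and> (\<forall>a\<ge>1. \<exists>K::real. \<forall>m::nat\<ge>1.
            L2_spectral_gap (gauss_target m) (rwm_kernel m (s * real m powr (- a)))
              \<le> ereal (K * real m powr (- a / 2)))"
proof (intro conjI allI impI)
  fix a p :: real
  assume a: "a \<ge> 0" "a < 1" and "p > 0"
  obtain K where K: "\<And>m::nat. m \<ge> 1 \<Longrightarrow> sqrt (2 * (s * real m powr (- a)) *
      (1 + (s * real m powr (- a)) / 2) powr (- (real m - 1) / 2)) \<le> K * real m powr (- p)"
    using rwm_gap_bound_superpolynomial[OF assms a] by blast
  have "L2_spectral_gap (gauss_target m) (rwm_kernel m (s * real m powr (- a)))
      \<le> ereal (K * real m powr (- p))" if m: "m \<ge> 1" for m :: nat
  proof -
    have "s * real m powr (- a) > 0" using m assms by simp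
    from rwm_spectral_gap_le[OF m this] show ?thesis
      by (rule order_trans) (simp only: ereal_less_eq K[OF m])
  qed
  then show "\<exists>K::real. \<forall>m::nat\<ge>1.
      L2_spectral_gap (gauss_target m) (rwm_kernel m (s * real m powr (- a)))
        \<le> ereal (K * real m powr (- p))" by blast
next
  fix a :: real
  have "L2_spectral_gap (gauss_target m) (rwm_kernel m (s * real m powr (- a)))
      \<le> ereal (sqrt (2 * s) * real m powr (- a / 2))" if m: "m \<ge> 1" for m :: nat
  proof -
    define \<delta> where "\<delta> = s * real m powr (- a)"
    have \<delta>: "\<delta> > 0" using m assms by (simp add: \<delta>_def)
    have "(1 + \<delta> / 2) powr (- (real m - 1) / 2) \<le> (1 + \<delta> / 2) powr 0"
      using \<delta> m by (intro powr_mono) auto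
    then have "2 * \<delta> * (1 + \<delta> / 2) powr (- (real m - 1) / 2) \<le> 2 * \<delta>"
      using \<delta> by simp
    then have "sqrt (2 * \<delta> * (1 + \<delta> / 2) powr (- (real m - 1) / 2)) \<le> sqrt (2 * \<delta>)"
      by (rule real_sqrt_le_mono)
    also have "sqrt (2 * \<delta>) = sqrt (2 * s) * real m powr (- a / 2)"
      using m by (simp add: \<delta>_def real_sqrt_mult powr_half_sqrt[symmetric] powr_powr)
    finally have "ereal (sqrt (2 * \<delta> * (1 + \<delta> / 2) powr (- (real m - 1) / 2)))
        \<le> ereal (sqrt (2 * s) * real m powr (- a / 2))" by (simp only: ereal_less_eq)
    with rwm_spectral_gap_le[OF m \<delta>] show ?thesis
      unfolding \<delta>_def by (rule order_trans)
  qed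
  then show "\<exists>K::real. \<forall>m::nat\<ge>1.
      L2_spectral_gap (gauss_target m) (rwm_kernel m (s * real m powr (- a)))
        \<le> ereal (K * real m powr (- a / 2))" by blast
qed

end
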